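(* There is an absolute constant $c>0$ such that for every $N$ there exist a finite convex set $A\subset\mathbb{R}$ with $|A|\ge N$ and an element $x\in A$ such that $x$ is the centre of at least $c|A|^{2/3}$ three-term arithmetic progressions in $A$, i.e. $|\{(b,d)\in A^2: b+d=2x\}|\geq c|A|^{2/3}$.
   Context: A convex set is a finite set $A=\{a_1<\cdots<a_n\}\subset\mathbb{R}$ whose consecutive differences $a_{i+1}-a_i$ form a strictly increasing sequence. *)

theory Defs
  imports Complex_Main
begin

text \<open>
  The additive-combinatorial notion: a finite set
  \<open>A = {a 1 < \<dots> < a n}\<close> of reals whose consecutive differences
  \<open>a (i + 1) - a i\<close>, for \<open>1 \<le> i < n\<close>, strictly increase. It is unrelated to
  convexity in the sense of \<open>HOL-Analysis\<close>. The increasing enumeration of a finite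
  set is unique, so quantifying it existentially involves no choice.
\<close>

definition convex_set :: "real set \<Rightarrow> bool" where
  "convex_set A \<longleftrightarrow>
     (\<exists>(n::nat) (a::nat \<Rightarrow> real).
        A = a ` {1..n} \<and>
        strict_mono_on {1..n} a \<and>
        strict_mono_on {1..<n} (\<lambda>i. a (i + 1) - a i))"

end

theory Submission
  imports Defs
begin

text \<open>
  Put the centre at \<open>0\<close>. The positive part of \<open>A\<close> is then a convex sequence \<open>f 0, \<dots>, f m\<close>
  and, reflected, the negative part is a concave sequence \<open>g 0, \<dots>, g m\<close>; each coincidence
  \<open>f i = g j\<close> yields a progression. Take \<open>f\<close> to be a tiny convex perturbation of the identity
  and \<open>g = f \<circ> h\<close>, where \<open>h\<close> is concave enough for \<open>g\<close> to stay concave: the coincidences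
  are then the integer points on the graph of \<open>h\<close>. A convex lattice polygon whose edges, sorted by
  slope, are the vectors \<open>(p + q, p)\<close> with \<open>p, q \<le> K\<close> coprime has at least \<open>K\<^sup>2 / 4\<close> vertices
  and width at most \<open>m = 2 K\<^sup>3\<close>, and \<open>h\<close> is a minimum of parabolas touching it at its vertices.
\<close>

section \<open>Convex sets from a convex and a concave sequence\<close>

lemma strict_mono_on_Suc:
  fixes a :: "nat \<Rightarrow> real"
  assumes "\<And>k. l \<le> k \<Longrightarrow> Suc k < r \<Longrightarrow> a k < a (Suc k)"
  shows "strict_mono_on {l..<r} a"
proof (rule strict_mono_onI)
  fix i j assume "i \<in> {l..<r}" "j \<in> {l..<r}" "i < j"
  then have "Suc i \<le> j" "l \<le> i" "j < r" by auto
  then show "a i < a j"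
  proof (induction j rule: dec_induct)
    case base
    then show ?case using assms by simp
  next
    case (step n)
    then show ?case using assms[of n] by simp
  qed
qed

text \<open>Read from left to right, the negated values of \<open>g\<close> are traversed backwards,
  so the shrinking increments of the concave \<open>g\<close> appear as growing ones. The halves
  share the point 0, and \<open>g 1 < f 1\<close> is the comparison of the two differences meeting
  there.\<close>

lemma convex_set_glue:
  fixes f g :: "nat \<Rightarrow> real"
  assumes f: "\<And>i. f (Suc i) - f i < f (Suc (Suc i)) - f (Suc i)"
    and g: "\<And>j. Suc (Suc j) \<le> m \<Longrightarrow> g (Suc (Suc j)) - g (Suc j) < g (Suc j) - g j"
    and g_mono: "\<And>j. j < m \<Longrightarrow> g j < g (Suc j)"
    and f_mono: "\<And>i. f i < f (Suc i)"
    and zero: "f 0 = 0" "g 0 = 0" and slope: "g 1 < f 1"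
  shows "convex_set (f ` {..m} \<union> (\<lambda>j. - g j) ` {..m})" (is "convex_set ?A")
    and "card (f ` {..m} \<union> (\<lambda>j. - g j) ` {..m}) = 2 * m + 1"
proof -
  \<comment> \<open>The enumeration starts at 1, so 0 gets the middle index \<open>m + 1\<close>.
    Both halves agree there, which lets \<open>left\<close> and \<open>right\<close> both hold at
    offset 0.\<close>
  define a where "a k = (if k \<le> m + 1 then - g (m + 1 - k) else f (k - (m + 1)))" for k
  have left: "a (m + 1 - j) = - g j" if "j \<le> m" for j
    using that by (simp add: a_def)
  have right: "a (m + 1 + i) = f i" for i
    by (simp add: a_def zero)
  have image: "a ` {1..2 * m + 1} = ?A"
  proof
    show "a ` {1..2 * m + 1} \<subseteq> ?A"
    proof
      fix y assume "y \<in> a ` {1..2 * m + 1}"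
      then obtain k where k: "1 \<le> k" "k \<le> 2 * m + 1" "y = a k" by auto
      show "y \<in> ?A"
      proof (cases "k \<le> m + 1")
        case True
        then show ?thesis using k by (auto simp: a_def)
      next
        case False
        then show ?thesis using k by (auto simp: a_def)
      qed
    qed
    show "?A \<subseteq> a ` {1..2 * m + 1}"
    proof
      fix y assume "y \<in> ?A"
      then consider j where "j \<le> m" "y = - g j" | i where "i \<le> m" "y = f i" by auto
      then show "y \<in> a ` {1..2 * m + 1}"
      proof cases
        case 1
        then show ?thesis using left by (intro image_eqI[of _ _ "m + 1 - j"]) auto
      next
        case 2
        then show ?thesis using right by (intro image_eqI[of _ _ "m + 1 + i"]) auto
      qed
    qed
  qed
  have mono: "strict_mono_on {1..2 * m + 1} a"
  proof -
    have "strict_mono_on {1..<2 * m + 2} a"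
    proof (rule strict_mono_on_Suc)
      fix k assume k: "1 \<le> k" "Suc k < 2 * m + 2"
      show "a k < a (Suc k)"
      proof (cases "k \<le> m")
        case True
        then have "Suc (m - k) = m + 1 - k" by simp
        then show ?thesis using True k g_mono[of "m - k"] by (simp add: a_def)
      next
        case False
        then obtain i where "k = m + 1 + i" by (metis not_less_eq_eq le_iff_add Suc_eq_plus1)
        then show ?thesis using right[of i] right[of "Suc i"] f_mono[of i] by simp
      qed
    qed
    then show ?thesis by (simp add: atLeastLessThanSuc_atLeastAtMost)
  qed
  have diff: "strict_mono_on {1..<2 * m + 1} (\<lambda>i. a (i + 1) - a i)"
  proof (rule strict_mono_on_Suc)
    fix k assume k: "1 \<le> k" "Suc k < 2 * m + 1"
    consider "k < m" | "k = m" | "m < k" by linarith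
    then show "a (k + 1) - a k < a (Suc k + 1) - a (Suc k)"
    proof cases
      case 1
      then obtain j where "m = k + Suc j" by (metis less_imp_Suc_add add_Suc_right)
      then show ?thesis using k g[of j] left[of "Suc (Suc j)"] left[of "Suc j"] left[of j] by simp
    next
      case 2
      then show ?thesis using k left[of 1] left[of 0] right[of 1] slope zero by simp
    next
      case 3
      then obtain i where "k = m + 1 + i" by (metis Suc_leI le_iff_add Suc_eq_plus1)
      then show ?thesis using f[of i] right[of i] right[of "Suc i"] right[of "Suc (Suc i)"] by simp
    qed
  qed
  show "convex_set ?A"
    unfolding convex_set_def using image mono diff by blast
  have "card ?A = card {1..2 * m + 1}"
    unfolding image[symmetric] using mono by (intro card_image strict_mono_on_imp_inj_on)
  then show "card ?A = 2 * m + 1" by simp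
qed

text \<open>A common strictly convex map \<open>F\<close> is applied to the identity and to
  \<open>h\<close>. It makes the first sequence convex, while the reserve \<open>e\<close> in the
  concavity of \<open>h\<close> keeps the second one concave. Whenever \<open>h j\<close> is an
  integer \<open>i\<close>, the values \<open>F i\<close> and \<open>- F (h j)\<close> are symmetric
  about 0.\<close>

lemma convex_set_of_concave:
  fixes h :: "nat \<Rightarrow> real"
  assumes e: "e > 0" and zero: "h 0 = 0"
    and incr: "\<And>j. j < m \<Longrightarrow> h j < h (Suc j)" "\<And>j. j < m \<Longrightarrow> h (Suc j) < h j + 1"
    and concave: "\<And>j. Suc (Suc j) \<le> m \<Longrightarrow> h (Suc (Suc j)) + h j + e \<le> 2 * h (Suc j)"
    and "m > 0"
  shows "\<exists>A. convex_set A \<and> card A = 2 * m + 1 \<and> 0 \<in> A \<and>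
    card {j. j \<le> m \<and> h j \<in> \<nat>} \<le> card {(b, d). b \<in> A \<and> d \<in> A \<and> b + d = 2 * 0}"
proof -
  \<comment> \<open>The factor \<open>e / 4\<close> is small enough: with increments of
    \<open>h\<close> in (0, 1), the quadratic term adds less than \<open>e / 2\<close> to a second
    difference that is at most \<open>- e\<close>.\<close>
  define F where "F x = x + e / 4 * x\<^sup>2" for x :: real
  define A where "A = (\<lambda>i. F (real i)) ` {..m} \<union> (\<lambda>j. - F (h j)) ` {..m}"
  have h_bounds: "0 \<le> h j \<and> h j \<le> j" if "j \<le> m" for j
    using that
  proof (induction j)
    case (Suc j)
    then show ?case using incr[of j] by simp
  qed (simp add: zero)
  have F_mono: "F x < F y" if "0 \<le> x" "x < y" for x y
  proof -
    have "e / 4 * x\<^sup>2 \<le> e / 4 * y\<^sup>2"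
      using that e by (intro mult_left_mono power_mono) auto
    then show ?thesis unfolding F_def using that by linarith
  qed
  have g_mono: "F (h j) < F (h (Suc j))" if "j < m" for j
    using that h_bounds[of j] incr(1)[of j] by (intro F_mono) auto
  have g_concave: "F (h (Suc (Suc j))) - F (h (Suc j)) < F (h (Suc j)) - F (h j)"
    if j: "Suc (Suc j) \<le> m" for j
  proof -
    define b where "b = h (Suc j) - h j"
    define a where "a = h (Suc (Suc j)) - h (Suc j)"
    have ab: "0 < a" "a < 1" "0 < b" "b < 1" "a + e \<le> b" "0 \<le> h (Suc j)"
      using j incr[of j] incr[of "Suc j"] concave[of j] h_bounds[of "Suc j"]
      by (auto simp: a_def b_def)
    have sq: "a\<^sup>2 < 1" "b\<^sup>2 < 1" using ab by (auto simp: power_less_one_iff)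
    have "2 * h (Suc j) * (a - b) \<le> 0"
      using ab e by (intro mult_nonneg_nonpos) auto
    then have *: "2 * h (Suc j) * (a - b) + a\<^sup>2 + b\<^sup>2 < 2" using sq by linarith
    have "F (h (Suc (Suc j))) - F (h (Suc j)) - (F (h (Suc j)) - F (h j))
      = (a - b) + e / 4 * (2 * h (Suc j) * (a - b) + a\<^sup>2 + b\<^sup>2)"
      unfolding F_def a_def b_def by (simp add: power2_eq_square algebra_simps)
    also have "\<dots> < (a - b) + e / 4 * 2"
      using * e by (intro add_strict_left_mono mult_strict_left_mono) auto
    also have "\<dots> < 0" using ab e by linarith
    finally show ?thesis by simp
  qed
  have f_convex: "F (real (Suc i)) - F (real i) < F (real (Suc (Suc i))) - F (real (Suc i))" for i
    unfolding F_def using e by (simp add: power2_eq_square algebra_simps)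
  have first: "F (h 1) < F (real 1)"
    using incr(2)[of 0] h_bounds[of 1] \<open>m > 0\<close> zero by (intro F_mono) auto
  have A: "convex_set A" "card A = 2 * m + 1"
    unfolding A_def
    by (rule convex_set_glue[where f = "\<lambda>i. F (real i)" and g = "\<lambda>j. F (h j)"];
        use f_convex g_concave g_mono F_mono first in \<open>simp add: F_def zero\<close>)+
  have A0: "0 \<in> A"
    unfolding A_def by (rule UnI1, rule image_eqI[of _ _ 0]) (auto simp: F_def)
  let ?T = "{j. j \<le> m \<and> h j \<in> \<nat>}"
  let ?P = "{(b, d). b \<in> A \<and> d \<in> A \<and> b + d = 2 * 0}"
  have "finite A" unfolding A_def by simp
  then have fin: "finite ?P" by (intro finite_subset[of ?P "A \<times> A"]) auto
  \<comment> \<open>Different integer points on the graph must yield different pairs; this follows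
    from the strict growth of \<open>F (h j)\<close>.\<close>
  have inj: "inj_on (\<lambda>j. (F (h j), - F (h j))) ?T"
  proof -
    have "strict_mono_on {0..<Suc m} (\<lambda>j. F (h j))"
      using g_mono by (intro strict_mono_on_Suc) auto
    then have "inj_on (\<lambda>j. F (h j)) {0..<Suc m}" by (rule strict_mono_on_imp_inj_on)
    then show ?thesis by (auto simp: inj_on_def)
  qed
  have sub: "(\<lambda>j. (F (h j), - F (h j))) ` ?T \<subseteq> ?P"
  proof (clarsimp)
    fix j assume j: "j \<le> m" "h j \<in> \<nat>"
    then obtain i where i: "h j = real i" by (auto simp: Nats_def)
    then have "i \<le> m" using h_bounds[OF j(1)] j(1) by simp
    moreover have "- F (h j) \<in> (\<lambda>j. - F (h j)) ` {..m}" using j(1) by blast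
    ultimately show "F (h j) \<in> A \<and> - F (h j) \<in> A" using i by (auto simp: A_def)
  qed
  have "card ?T \<le> card ?P" by (rule card_inj_on_le[OF inj sub fin])
  then show ?thesis using A A0 by blast
qed

section \<open>Minima of parabolas touching a concave polygon\<close>

text \<open>
  The edges \<open>u\<close> have slope \<open>\<sigma> u\<close> and width \<open>w u\<close>; \<open>(J s, I s)\<close> is the vertex where the
  edge \<open>s\<close> starts. The line of slope \<open>\<sigma> s + \<eta>\<close> through it, strictly between the two adjacent
  edge slopes, passes above every other vertex with room for the quadratic term.
\<close>

lemma parabola_above_vertex:
  fixes \<sigma> w :: "'a \<Rightarrow> real"
  defines "J \<equiv> \<lambda>s S. \<Sum>u | u \<in> S \<and> \<sigma> s < \<sigma> u. w u"
    and "I \<equiv> \<lambda>s S. \<Sum>u | u \<in> S \<and> \<sigma> s < \<sigma> u. \<sigma> u * w u"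
  assumes S: "finite S" "s \<in> S" "t \<in> S" and w: "\<And>u. u \<in> S \<Longrightarrow> 0 \<le> w u"
    and gap: "\<And>u v. u \<in> S \<Longrightarrow> v \<in> S \<Longrightarrow> \<sigma> u < \<sigma> v \<Longrightarrow> \<sigma> u + 2 * \<eta> \<le> \<sigma> v"
    and e: "0 \<le> e" "e * (\<Sum>u\<in>S. w u) \<le> \<eta>"
  shows "I t S \<le> I s S + (\<sigma> s + \<eta>) * (J t S - J s S) - e * (J t S - J s S)\<^sup>2"
proof -
  \<comment> \<open>These are the edges traversed between the vertices of \<open>b\<close> and
    \<open>a\<close>, and \<open>\<Delta>\<close> is their total width.\<close>
  define D where "D a b = {u \<in> S. \<sigma> a < \<sigma> u \<and> \<sigma> u \<le> \<sigma> b}" for a b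
  define \<Delta> where "\<Delta> a b = sum w (D a b)" for a b
  have split: "J a S = J b S + \<Delta> a b" "I a S = I b S + (\<Sum>u\<in>D a b. \<sigma> u * w u)"
    if "\<sigma> a < \<sigma> b" for a b
  proof -
    have "{u \<in> S. \<sigma> a < \<sigma> u} = {u \<in> S. \<sigma> b < \<sigma> u} \<union> D a b"
      "{u \<in> S. \<sigma> b < \<sigma> u} \<inter> D a b = {}" "finite (D a b)"
      using that S by (auto simp: D_def)
    then show "J a S = J b S + \<Delta> a b" "I a S = I b S + (\<Sum>u\<in>D a b. \<sigma> u * w u)"
      unfolding J_def I_def \<Delta>_def using S by (simp_all add: sum.union_disjoint)
  qed
  have \<Delta>: "0 \<le> \<Delta> a b" "e * (\<Delta> a b)\<^sup>2 \<le> \<eta> * \<Delta> a b" for a b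
  proof -
    show nn: "0 \<le> \<Delta> a b" unfolding \<Delta>_def D_def using w by (intro sum_nonneg) auto
    have "\<Delta> a b \<le> (\<Sum>u\<in>S. w u)"
      unfolding \<Delta>_def D_def using w S by (intro sum_mono2) auto
    then have "e * \<Delta> a b \<le> \<eta>"
      using e by (meson mult_left_mono order_trans)
    then show "e * (\<Delta> a b)\<^sup>2 \<le> \<eta> * \<Delta> a b"
      using nn mult_right_mono[of "e * \<Delta> a b" \<eta> "\<Delta> a b"] by (simp add: power2_eq_square mult.assoc)
  qed
  consider "\<sigma> s < \<sigma> t" | "\<sigma> t < \<sigma> s" | "\<sigma> s = \<sigma> t" by linarith
  then show ?thesis
  proof cases
    \<comment> \<open>The vertex of \<open>t\<close> lies to the left of that of \<open>s\<close>.
      The edges between are steeper than the line by at least \<open>\<eta>\<close>, so the line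
      clears the vertex by \<open>\<eta> * \<Delta> s t\<close>, which pays for the quadratic
      term.\<close>
    case 1
    have "(\<sigma> s + 2 * \<eta>) * \<Delta> s t \<le> (\<Sum>u\<in>D s t. \<sigma> u * w u)"
      unfolding \<Delta>_def sum_distrib_left using gap S w
      by (intro sum_mono mult_right_mono) (auto simp: D_def)
    then show ?thesis using split[OF 1] \<Delta>[of s t] by (simp add: algebra_simps)
  next
    \<comment> \<open>Now the vertex of \<open>t\<close> lies to the right, and the edges between
      have slope at most \<open>\<sigma> s\<close>, again \<open>\<eta>\<close> below that of the
      line.\<close>
    case 2
    have "(\<Sum>u\<in>D t s. \<sigma> u * w u) \<le> \<sigma> s * \<Delta> t s"
      unfolding \<Delta>_def sum_distrib_left using w
      by (intro sum_mono mult_right_mono) (auto simp: D_def)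
    then show ?thesis using split[OF 2] \<Delta>[of t s] by (simp add: algebra_simps)
  next
    case 3
    then show ?thesis by (simp add: J_def I_def)
  qed
qed

text \<open>Each parabola has second difference exactly \<open>- 2 * e\<close>, and taking a minimum
  can only lower a second difference. On the range up to \<open>m\<close> the quadratic term changes
  an increment by at most \<open>2 * e * m\<close>, so all parabolas have increments in (0, 1), a
  property that passes to the minimum.\<close>

lemma Min_parabolas:
  fixes c J I :: "'a \<Rightarrow> real" and e :: real and S :: "'a set"
  defines "P \<equiv> \<lambda>s x. I s + c s * (x - J s) - e * (x - J s)\<^sup>2"
  defines "h \<equiv> \<lambda>j::nat. Min ((\<lambda>s. P s (real j)) ` S)"
  assumes S: "finite S" "S \<noteq> {}" and e: "0 \<le> e"
    and J: "\<And>s. s \<in> S \<Longrightarrow> 0 \<le> J s \<and> J s \<le> real m"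
    and c: "\<And>s. s \<in> S \<Longrightarrow> 2 * e * real m < c s \<and> c s < 1 - 2 * e * real m"
  shows "h (Suc (Suc j)) + h j + 2 * e \<le> 2 * h (Suc j)"
    and "j < m \<Longrightarrow> h j < h (Suc j)" and "j < m \<Longrightarrow> h (Suc j) < h j + 1"
proof -
  have le: "h j \<le> P s (real j)" if "s \<in> S" for s j
    using that S by (simp add: h_def)
  have attained: "\<exists>s\<in>S. h j = P s (real j)" for j
    using S Min_in[of "(\<lambda>s. P s (real j)) ` S"] by (auto simp: h_def simp del: Min_in)
  have incr: "P s (real j) < P s (real (Suc j)) \<and> P s (real (Suc j)) < P s (real j) + 1"
    if "s \<in> S" "j < m" for s j
  proof -
    have "P s (real (Suc j)) - P s (real j) = c s - e * (2 * (real j - J s) + 1)"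
      unfolding P_def by (simp add: power2_eq_square algebra_simps)
    moreover have "real j + 1 \<le> real m" using that(2) by linarith
    then have "\<bar>2 * (real j - J s) + 1\<bar> \<le> 2 * real m" using J[OF that(1)] by auto
    then have "\<bar>e * (2 * (real j - J s) + 1)\<bar> \<le> e * (2 * real m)"
      unfolding abs_mult using e by (intro mult_mono) auto
    ultimately show ?thesis using c[OF that(1)] by auto
  qed
  show "h (Suc (Suc j)) + h j + 2 * e \<le> 2 * h (Suc j)"
  proof -
    \<comment> \<open>A parabola attaining the minimum at the middle point bounds \<open>h\<close>
      from above at both neighbours.\<close>
    obtain s where s: "s \<in> S" "h (Suc j) = P s (real (Suc j))" using attained by blast
    have "P s (real (Suc (Suc j))) + P s (real j) + 2 * e = 2 * P s (real (Suc j))"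
      unfolding P_def by (simp add: power2_eq_square algebra_simps)
    then show ?thesis using s le[OF s(1), of j] le[OF s(1), of "Suc (Suc j)"] by linarith
  qed
  assume j: "j < m"
  show "h j < h (Suc j)"
    using attained[of "Suc j"] incr[OF _ j] le[of _ j] by fastforce
  show "h (Suc j) < h j + 1"
    using attained[of j] incr[OF _ j] le[of _ "Suc j"] by fastforce
qed

section \<open>Counting coprime pairs\<close>

text \<open>The induction proves the sharper bound \<open>3 / 4 - 1 / n\<close>, which telescopes
  and is an equality at \<open>n = 2\<close>.\<close>

lemma sum_inverse_squares_le:
  "(\<Sum>d = 2..n. 1 / (real d)\<^sup>2) \<le> 3 / 4"
proof (cases "n \<ge> 2")
  case True
  then have "(\<Sum>d = 2..n. 1 / (real d)\<^sup>2) \<le> 3 / 4 - 1 / real n"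
  proof (induction n rule: dec_induct)
    case (step n)
    have "1 / (real (Suc n))\<^sup>2 \<le> 1 / (real n * real (Suc n))"
      using step by (intro divide_left_mono) (auto simp: power2_eq_square)
    also have "\<dots> = 1 / real n - 1 / real (Suc n)"
      using step by (simp add: field_simps)
    finally show ?case using step by simp
  qed simp
  then show ?thesis using True by (smt (verit) divide_nonneg_nonneg of_nat_0_le_iff)
qed simp

definition coprime_pairs :: "nat \<Rightarrow> (nat \<times> nat) set" where
  "coprime_pairs K = {(p, q). p \<in> {1..K} \<and> q \<in> {1..K} \<and> coprime p q}"

lemma coprime_pairs_subset: "coprime_pairs K \<subseteq> {1..K} \<times> {1..K}"
  by (auto simp: coprime_pairs_def)

lemma finite_coprime_pairs [simp]: "finite (coprime_pairs K)"
  by (rule finite_subset[OF coprime_pairs_subset]) simp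

text \<open>A non-coprime pair is \<open>d\<close> times a pair from the square of side
  \<open>K div d\<close>, where \<open>d\<close> is its gcd and at least 2. The union bound discards
  at most three quarters of the square.\<close>

lemma card_coprime_pairs_ge: "real K ^ 2 / 4 \<le> real (card (coprime_pairs K))"
proof -
  let ?B = "\<lambda>d. (\<lambda>(a, b). (d * a, d * b)) ` ({1..K div d} \<times> {1..K div d})"
  have cover: "{1..K} \<times> {1..K} \<subseteq> coprime_pairs K \<union> (\<Union>d\<in>{2..K}. ?B d)"
  proof (clarify)
    fix p q assume pq: "p \<in> {1..K}" "q \<in> {1..K}" "(p, q) \<notin> (\<Union>d\<in>{2..K}. ?B d)"
    show "(p, q) \<in> coprime_pairs K"
    proof (rule ccontr)
      assume "(p, q) \<notin> coprime_pairs K"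
      then have "gcd p q \<noteq> 1" using pq by (auto simp: coprime_pairs_def coprime_iff_gcd_eq_1)
      moreover have "gcd p q > 0" using pq by auto
      moreover have "gcd p q \<le> K" using pq gcd_le1_nat[of p q] by (simp; linarith)
      ultimately have d: "gcd p q \<in> {2..K}" unfolding atLeastAtMost_iff by linarith
      have in_range: "x div gcd p q \<in> {1..K div gcd p q}" if "x \<in> {1..K}" "gcd p q dvd x" for x
        using that \<open>gcd p q > 0\<close> by (auto simp: div_le_mono Suc_le_eq div_greater_zero_iff dvd_imp_le)
      have "(p, q) \<in> ?B (gcd p q)"
        using in_range pq by (intro image_eqI[of _ _ "(p div gcd p q, q div gcd p q)"]) auto
      then show False using d pq by blast
    qed
  qed
  have "K ^ 2 = card ({1..K} \<times> {1..K})" by (simp add: power2_eq_square)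
  also have "\<dots> \<le> card (coprime_pairs K \<union> (\<Union>d\<in>{2..K}. ?B d))"
    by (intro card_mono cover) auto
  also have "\<dots> \<le> card (coprime_pairs K) + card (\<Union>d\<in>{2..K}. ?B d)" by (rule card_Un_le)
  also have "card (\<Union>d\<in>{2..K}. ?B d) \<le> (\<Sum>d = 2..K. card (?B d))"
    by (intro card_UN_le) simp
  also have "(\<Sum>d = 2..K. card (?B d)) \<le> (\<Sum>d = 2..K. (K div d)\<^sup>2)"
    by (intro sum_mono order_trans[OF card_image_le]) (auto simp: power2_eq_square)
  finally have "real (K ^ 2) \<le> real (card (coprime_pairs K)) + real (\<Sum>d = 2..K. (K div d)\<^sup>2)"
    by (simp only: of_nat_add[symmetric] of_nat_le_iff)
  also have "real (\<Sum>d = 2..K. (K div d)\<^sup>2) \<le> (\<Sum>d = 2..K. real K ^ 2 * (1 / (real d)\<^sup>2))"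
  proof -
    have "real ((K div d)\<^sup>2) \<le> real K ^ 2 * (1 / (real d)\<^sup>2)" for d
      using power_mono[OF of_nat_div_le_of_nat[of K d, where 'a = real], of 2]
      by (simp add: power_divide)
    then show ?thesis unfolding of_nat_sum by (intro sum_mono)
  qed
  also have "\<dots> = real K ^ 2 * (\<Sum>d = 2..K. 1 / (real d)\<^sup>2)" by (rule sum_distrib_left[symmetric])
  also have "\<dots> \<le> real K ^ 2 * (3 / 4)"
    by (intro mult_left_mono sum_inverse_squares_le) simp
  finally show ?thesis by simp
qed

section \<open>Slopes of the polygon edges\<close>

text \<open>The pair (p, q) stands for the edge vector (p + q, p). The shear from (q, p) keeps all
  slopes for positive p and q strictly between 0 and 1, as the increments of \<open>h\<close>
  require.\<close>

definition slope :: "nat \<times> nat \<Rightarrow> real" where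
  "slope s = real (fst s) / real (fst s + snd s)"

text \<open>Over the common denominator, the numerator of the difference is a positive integer,
  hence at least 1, and each denominator is at most \<open>2 * K\<close>.\<close>

lemma slope_gap:
  assumes "s \<in> coprime_pairs K" "t \<in> coprime_pairs K" "slope s < slope t"
  shows "slope s + 1 / (4 * real K ^ 2) \<le> slope t"
proof -
  obtain p q p' q' where st: "s = (p, q)" "t = (p', q')" by fastforce
  have b: "1 \<le> p" "p \<le> K" "1 \<le> q" "q \<le> K" "1 \<le> p'" "p' \<le> K" "1 \<le> q'" "q' \<le> K"
    using assms by (auto simp: st coprime_pairs_def)
  define u v where "u = real (p + q)" and "v = real (p' + q')"
  have uv: "0 < u" "u \<le> 2 * real K" "0 < v" "v \<le> 2 * real K" using b by (auto simp: u_def v_def)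
  have eq: "slope t - slope s = (real p' * u - real p * v) / (u * v)"
    using uv by (simp add: slope_def st u_def[symmetric] v_def[symmetric] field_simps
        flip: of_nat_add)
  have "0 < (real p' * u - real p * v) / (u * v)" using assms(3) eq by simp
  then have "real p * v < real p' * u" using mult_pos_pos[OF uv(1,3)]
    by (auto simp: zero_less_divide_iff)
  then have "p * (p' + q') < p' * (p + q)"
    unfolding u_def v_def by (simp only: of_nat_mult[symmetric] of_nat_less_iff)
  then have "real (p * (p' + q') + 1) \<le> real (p' * (p + q))" by (simp only: of_nat_le_iff)
  then have "1 \<le> real p' * u - real p * v" by (simp add: u_def v_def)
  then have "1 / (u * v) \<le> slope t - slope s"
    unfolding eq using uv by (intro divide_right_mono) auto
  moreover have "u * v \<le> (2 * real K) * (2 * real K)" using uv by (intro mult_mono) auto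
  then have "1 / (4 * real K ^ 2) \<le> 1 / (u * v)"
    using uv by (intro divide_left_mono) (auto simp: power2_eq_square)
  ultimately show ?thesis by linarith
qed

lemma inj_on_slope: "inj_on slope (coprime_pairs K)"
proof (rule inj_onI)
  fix s t assume st: "s \<in> coprime_pairs K" "t \<in> coprime_pairs K" "slope s = slope t"
  obtain p q p' q' where eq: "s = (p, q)" "t = (p', q')" by fastforce
  have b: "1 \<le> p" "1 \<le> q" "1 \<le> p'" "1 \<le> q'" "coprime p q" "coprime p' q'"
    using st by (auto simp: eq coprime_pairs_def)
  have "real p * real (p' + q') = real p' * real (p + q)"
    using st(3) b unfolding slope_def eq by (simp add: frac_eq_eq del: of_nat_add)
  then have "p * (p' + q') = p' * (p + q)" by (simp only: of_nat_mult[symmetric] of_nat_eq_iff)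
  then have "p * q' = p' * q" by (simp add: algebra_simps)
  then show "s = t" using b coprime_crossproduct_nat[of p q p' q'] 
    by (simp add: eq mult.commute)
qed

section \<open>A concave function with many integer values\<close>

lemma concave_through_lattice_points:
  assumes K: "K \<ge> 1"
  shows "\<exists>h e. e > 0 \<and> h 0 = 0 \<and>
    (\<forall>j < 2 * K ^ 3. h j < h (Suc j) \<and> h (Suc j) < h j + 1) \<and>
    (\<forall>j. h (Suc (Suc j)) + h j + e \<le> (2 * h (Suc j) :: real)) \<and>
    card (coprime_pairs K) \<le> card {j. j \<le> 2 * K ^ 3 \<and> h j \<in> \<nat>}"
proof -
  define S where "S = coprime_pairs K"
  \<comment> \<open>There are at most \<open>K * K\<close> edges, each of width at most
    \<open>2 * K\<close>.\<close>
  define m where "m = 2 * K ^ 3"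
  define w where "w s = fst s + snd s" for s :: "nat \<times> nat"
  \<comment> \<open>Concavity puts the steeper edges first, so the edges in \<open>U s\<close> lead
    from the origin to the start of \<open>s\<close>. \<open>J\<close> and \<open>I\<close> are
    natural numbers, so the vertices are lattice points.\<close>
  define U where "U s = {u \<in> S. slope s < slope u}" for s
  define J where "J s = (\<Sum>u\<in>U s. w u)" for s
  define I where "I s = (\<Sum>u\<in>U s. fst u)" for s
  \<comment> \<open>Twice \<open>\<eta>\<close> is the minimal slope gap. The next choice gives
    \<open>e * m = \<eta> / 4\<close>, which suffices both for the parabolas to clear the vertices
    and for their increments to stay in (0, 1).\<close>
  define \<eta> where "\<eta> = 1 / (8 * real K ^ 2)"
  define e where "e = \<eta> / (4 * real m)"
  define P where "P s x = real (I s) + (slope s + \<eta>) * (x - real (J s)) - e * (x - real (J s))\<^sup>2" for s x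
  define h where "h j = Min ((\<lambda>s. P s (real j)) ` S)" for j :: nat
  have S: "finite S" "S \<noteq> {}"
  proof -
    have "(1, 1) \<in> S" using K by (simp add: S_def coprime_pairs_def)
    then show "S \<noteq> {}" by blast
  qed (simp add: S_def)
  have pos: "0 < real m" "0 < \<eta>" "0 < e" using K by (auto simp: m_def \<eta>_def e_def)
  have em: "e * real m = \<eta> / 4" using pos by (simp add: e_def)
  have range: "1 \<le> fst s \<and> fst s \<le> K \<and> 1 \<le> snd s \<and> snd s \<le> K" if "s \<in> S" for s
    using that by (auto simp: S_def coprime_pairs_def)
  have total: "(\<Sum>u\<in>S. w u) \<le> m"
  proof -
    have "(\<Sum>u\<in>S. w u) \<le> of_nat (card S) * (2 * K)"
      using range by (intro sum_bounded_above) (fastforce simp: w_def)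
    also have "card S \<le> K * K"
      using card_mono[OF _ coprime_pairs_subset[of K]] by (simp add: S_def)
    finally show ?thesis by (simp add: m_def power3_eq_cube algebra_simps)
  qed
  have J_le: "J s \<le> m" for s
    using total sum_mono2[OF S(1), of "U s" w] by (force simp: J_def U_def)
  \<comment> \<open>The distance from the slope to 1 is q / (p + q), at least
    \<open>1 / (2 * K)\<close>, which exceeds \<open>2 * \<eta> = 1 / (4 * K ^ 2)\<close>.\<close>
  have slope_bounds: "0 < slope s \<and> slope s + 2 * \<eta> < 1" if "s \<in> S" for s
  proof
    show "0 < slope s" using range[OF that] by (simp add: slope_def)
    have "1 - slope s = real (snd s) / real (w s)"
      using range[OF that] by (simp add: slope_def w_def field_simps)
    also have "\<dots> \<ge> 1 / (2 * real K)"
      using range[OF that] by (intro frac_le) (auto simp: w_def)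
    finally have "1 - slope s \<ge> 1 / (2 * real K)" .
    moreover have "2 * \<eta> < 1 / (2 * real K)"
    proof -
      have "1 * 1 \<le> real K * real K" "real K * 1 \<le> real K * real K"
        using K by (intro mult_mono; simp)+
      then show ?thesis using K by (simp add: \<eta>_def field_simps power2_eq_square)
    qed
    ultimately show "slope s + 2 * \<eta> < 1" by linarith
  qed
  have lower: "real (I t) \<le> P s (real (J t))" if "s \<in> S" "t \<in> S" for s t
  proof -
    have I_eq: "real (I s) = (\<Sum>u | u \<in> S \<and> slope s < slope u. slope u * real (w u))" for s
      unfolding I_def U_def of_nat_sum
      by (intro sum.cong) (use range in \<open>fastforce simp: slope_def w_def\<close>)+
    have J_eq: "real (J s) = (\<Sum>u | u \<in> S \<and> slope s < slope u. real (w u))" for s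
      by (simp add: J_def U_def)
    show ?thesis
      unfolding P_def I_eq J_eq
    proof (rule parabola_above_vertex)
      show "slope u + 2 * \<eta> \<le> slope v" if "u \<in> S" "v \<in> S" "slope u < slope v" for u v
        using slope_gap[of u K v] that by (simp add: S_def \<eta>_def)
      have "e * (\<Sum>u\<in>S. real (w u)) \<le> e * real m"
        using total pos by (intro mult_left_mono) (auto simp flip: of_nat_sum)
      then show "e * (\<Sum>u\<in>S. real (w u)) \<le> \<eta>" using em pos by linarith
    qed (use S that pos in auto)
  qed
  \<comment> \<open>The parabola of \<open>t\<close> passes through its own vertex, and by
    \<open>lower\<close> no other parabola goes below it there.\<close>
  have vertex: "h (J t) = real (I t)" if "t \<in> S" for t
    unfolding h_def
  proof (rule Min_eqI)
    show "real (I t) \<in> (\<lambda>s. P s (real (J t))) ` S"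
      using that by (intro image_eqI[of _ _ t]) (auto simp: P_def)
    show "real (I t) \<le> y" if "y \<in> (\<lambda>s. P s (real (J t))) ` S" for y
      using that lower \<open>t \<in> S\<close> by blast
  qed (simp add: S)
  have h_props: "h (Suc (Suc j)) + h j + 2 * e \<le> 2 * h (Suc j)"
    "j < m \<Longrightarrow> h j < h (Suc j)" "j < m \<Longrightarrow> h (Suc j) < h j + 1" for j
  proof -
    have c: "2 * e * real m < slope s + \<eta> \<and> slope s + \<eta> < 1 - 2 * e * real m" if "s \<in> S" for s
      using slope_bounds[OF that] em pos by (simp add: mult.assoc)
    have J: "0 \<le> real (J s) \<and> real (J s) \<le> real m" for s using J_le by simp
    note * = Min_parabolas[where c = "\<lambda>s. slope s + \<eta>" and m = m
      and J = "\<lambda>s. real (J s)" and I = "\<lambda>s. real (I s)", OF S less_imp_le[OF pos(3)] J c]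
    show "h (Suc (Suc j)) + h j + 2 * e \<le> 2 * h (Suc j)"
      "j < m \<Longrightarrow> h j < h (Suc j)" "j < m \<Longrightarrow> h (Suc j) < h j + 1"
      unfolding h_def P_def by (rule *; assumption)+
  qed
  \<comment> \<open>The steepest edge starts at the origin, so the origin is itself one of the
    vertices.\<close>
  have h0: "h 0 = 0"
  proof -
    have "Max (slope ` S) \<in> slope ` S" using S by (intro Max_in) simp_all
    then obtain s where s: "s \<in> S" "Max (slope ` S) = slope s" by (rule imageE)
    have "slope u \<le> slope s" if "u \<in> S" for u
      unfolding s(2)[symmetric] using S that by simp
    then have "U s = {}" by (force simp: U_def)
    then show ?thesis using vertex[OF s(1)] by (simp add: J_def I_def)
  qed
  \<comment> \<open>The edge \<open>t\<close> itself, of positive width, precedes the start of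
    \<open>s\<close> but not its own start. Distinct edges thus have distinct starting
    abscissae.\<close>
  have J_less: "J t < J s" if "s \<in> S" "t \<in> S" "slope s < slope t" for s t
    unfolding J_def
  proof (rule sum_strict_mono2)
    show "t \<in> U s - U t" "0 < w t" using that range[of t] by (auto simp: U_def w_def)
  qed (use S that in \<open>auto simp: U_def\<close>)
  have "inj_on J S"
  proof (rule inj_onI)
    fix s t assume st: "s \<in> S" "t \<in> S" "J s = J t"
    then have "slope s = slope t" using J_less[of s t] J_less[of t s] by force
    then show "s = t" using st inj_on_slope by (auto simp: S_def inj_on_def)
  qed
  then have "card S = card (J ` S)" by (simp add: card_image)
  also have "\<dots> \<le> card {j. j \<le> m \<and> h j \<in> \<nat>}"
    using J_le vertex by (intro card_mono) auto
  finally have "card S \<le> card {j. j \<le> m \<and> h j \<in> \<nat>}" .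
  then show ?thesis
    using h_props h0 pos by (intro exI[of _ h] exI[of _ "2 * e"]) (auto simp: S_def m_def)
qed

section \<open>Choice of parameters and conclusion\<close>

theorem theorem3p7:
  shows "\<exists>c::real. c > 0 \<and>
    (\<forall>N::nat. \<exists>A::real set. convex_set A \<and> card A \<ge> N \<and>
      (\<exists>x\<in>A. real (card {(b, d). b \<in> A \<and> d \<in> A \<and> b + d = 2 * x})
                \<ge> c * real (card A) powr (2 / 3)))"
proof (intro exI[of _ "1 / 16 :: real"] conjI allI)
  fix N :: nat
  define K where "K = Suc N"
  have K: "K \<ge> 1" "N \<le> K" by (auto simp: K_def)
  obtain h e where h: "e > 0" "h 0 = (0::real)"
    "\<And>j. j < 2 * K ^ 3 \<Longrightarrow> h j < h (Suc j)" "\<And>j. j < 2 * K ^ 3 \<Longrightarrow> h (Suc j) < h j + 1"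
    "\<And>j. h (Suc (Suc j)) + h j + e \<le> 2 * h (Suc j)"
    "card (coprime_pairs K) \<le> card {j. j \<le> 2 * K ^ 3 \<and> h j \<in> \<nat>}"
    using concave_through_lattice_points[OF K(1)] by blast
  obtain A where A: "convex_set A" "card A = 2 * (2 * K ^ 3) + 1" "0 \<in> A"
    "card {j. j \<le> 2 * K ^ 3 \<and> h j \<in> \<nat>} \<le> card {(b, d). b \<in> A \<and> d \<in> A \<and> b + d = 2 * 0}"
    using convex_set_of_concave[of e h "2 * K ^ 3"] h K by auto
  have K3: "1 \<le> K ^ 3" "K \<le> K ^ 3" using K by (auto simp: self_le_power)
  \<comment> \<open>The size \<open>4 * K ^ 3 + 1\<close> is at most \<open>(2 * K) ^ 3\<close>, so
    its power 2/3 is at most \<open>4 * K ^ 2\<close>. Comparing with the \<open>K ^ 2 / 4\<close>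
    coprime pairs gives the constant 1/16.\<close>
  have "real (card A) powr (2 / 3) \<le> ((2 * real K) ^ 3) powr (2 / 3)"
  proof (rule powr_mono2)
    have "card A \<le> 8 * K ^ 3" using A(2) K3 by simp
    then have "real (card A) \<le> real (8 * K ^ 3)" by (simp only: of_nat_le_iff)
    then show "real (card A) \<le> (2 * real K) ^ 3" by (simp add: power_mult_distrib)
  qed auto
  also have "\<dots> = ((2 * real K) powr 3) powr (2 / 3)"
    using K by (simp add: powr_numeral)
  also have "\<dots> = (2 * real K)\<^sup>2"
    unfolding powr_powr using K by (simp add: powr_numeral)
  finally have "1 / 16 * real (card A) powr (2 / 3) \<le> real K ^ 2 / 4"
    by (simp add: power_mult_distrib)
  also have "\<dots> \<le> real (card {(b, d). b \<in> A \<and> d \<in> A \<and> b + d = 2 * 0})"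
    using card_coprime_pairs_ge[of K] h(6) A(4) by linarith
  finally have "\<exists>x\<in>A. 1 / 16 * real (card A) powr (2 / 3)
      \<le> real (card {(b, d). b \<in> A \<and> d \<in> A \<and> b + d = 2 * x})"
    using A(3) by blast
  moreover have "N \<le> card A" using A(2) K K3 by linarith
  ultimately show "\<exists>A. convex_set A \<and> N \<le> card A \<and>
      (\<exists>x\<in>A. 1 / 16 * real (card A) powr (2 / 3)
        \<le> real (card {(b, d). b \<in> A \<and> d \<in> A \<and> b + d = 2 * x}))"
    using A(1) by blast
qed simp

end
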